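(* Let $X$ be a nonempty finite set, let $\beta \in (0,1)$, let $f : X \to [0,1]$ be a function taking at least three distinct values over $X$, and define $X_{f=1} = \{x \in X : f(x) = 1\}$. There exists a function $g : X \to [0,1]$ that is both an F-proxy for $f$ (with parameter $\beta$) and catastrophic for $f$ if and only if $\beta \geq \dfrac{|X_{f=1}|+1}{|X|}$.
   Context: $X$ is a finite set (with its discrete Borel structure), $A=[0,1]$, $\mathcal M(X,A)$ is the set of (Borel measurable, here all) functions $X \to A$, and $\Delta(X)$ is the set of probability distributions on $X$. F-proxy: $g : X \to [0,1]$ is an F-proxy for $f$ when $\Pr_{x \sim \mathcal U(X)}[g(x) \neq f(x)] \leq \beta$, where $\mathcal U(X)$ is the uniform distribution on $X$. Optimizer: a map $\Omega : \mathbb R_{\geq 0} \times \mathcal M(X,A) \times \Delta(X) \to \Delta(X)$, written $(k,g,p) \mapsto \Omega_k(g,p)$, such that for all $g \in \mathcal M(X,A)$ and $p \in \Delta(X)$: (1) $\Omega_0(g,p) = p$; (2) $j<k$ implies $\mathbb E_{x\sim\Omega_j(g,p)}[g(x)] \leq \mathbb E_{x\sim\Omega_k(g,p)}[g(x)]$; (3) for all $M < \sup_{y\in X} g(y)$, $\lim_{k\to\infty} \Pr_{x\sim\Omega_k(g,p)}[g(x) > M] = 1$; (4) $\lim_{k\to\infty} \mathbb E_{x\sim\Omega_k(g,p)}[g(x)] = \sup_{y\in X} g(y)$. $\eta$-catastrophic: for a real number $\eta$ with $\inf_{y\in X} f(y) \leq \eta < \sup_{y\in X} f(y)$, a value function $g$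 is $\eta$-catastrophic for $f$ when for all initial priors $p \in \Delta(X)$ and all optimizers $\Omega$, $\limsup_{k\to\infty} \mathbb E_{x\sim\Omega_k(g,p)}[f(x)] \leq \eta$. It is catastrophic for $f$ when it is $\eta$-catastrophic for $f$ with $\eta = \inf_{y\in X} f(y)$. *)

theory Defs
  imports "HOL-Probability.Probability"
begin

text \<open>
  The finite set \<open>X\<close> is an arbitrary finite set over some type. Functions on \<open>X\<close> are taken
  extensional, so that they correspond one-to-one to the mathematical functions \<open>X \<rightarrow> [0,1]\<close>, and
  distributions on \<open>X\<close> are the probability mass functions supported in \<open>X\<close>.
\<close>

definition value_functions :: "'a set \<Rightarrow> ('a \<Rightarrow> real) set" where
  "value_functions X = X \<rightarrow>\<^sub>E {0..1}"

definition distributions_on :: "'a set \<Rightarrow> 'a pmf set" where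
  "distributions_on X = {p. set_pmf p \<subseteq> X}"

definition F_proxy :: "'a set \<Rightarrow> real \<Rightarrow> ('a \<Rightarrow> real) \<Rightarrow> ('a \<Rightarrow> real) \<Rightarrow> bool" where
  "F_proxy X \<beta> f g \<longleftrightarrow>
     g \<in> value_functions X \<and>
     measure_pmf.prob (pmf_of_set X) {x \<in> X. g x \<noteq> f x} \<le> \<beta>"

text \<open>
  An optimizer is a map on \<open>[0,\<infinity>) \<times> value_functions X \<times> distributions_on X\<close>, written
  \<open>\<Omega> k g p\<close>; its values outside of this domain are unconstrained and never used.
\<close>

definition optimizer ::
  "'a set \<Rightarrow> (real \<Rightarrow> ('a \<Rightarrow> real) \<Rightarrow> 'a pmf \<Rightarrow> 'a pmf) \<Rightarrow> bool" where
  "optimizer X \<Omega> \<longleftrightarrow>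
     (\<forall>g \<in> value_functions X. \<forall>p \<in> distributions_on X.
        (\<forall>k\<ge>0. \<Omega> k g p \<in> distributions_on X) \<and>
        \<Omega> 0 g p = p \<and>
        (\<forall>j\<ge>0. \<forall>k>j. measure_pmf.expectation (\<Omega> j g p) g
                       \<le> measure_pmf.expectation (\<Omega> k g p) g) \<and>
        (\<forall>M < (SUP y\<in>X. g y).
           ((\<lambda>k. measure_pmf.prob (\<Omega> k g p) {x \<in> X. g x > M}) \<longlongrightarrow> 1) at_top) \<and>
        ((\<lambda>k. measure_pmf.expectation (\<Omega> k g p) g) \<longlongrightarrow> (SUP y\<in>X. g y)) at_top)"

definition eta_catastrophic ::
  "'a set \<Rightarrow> real \<Rightarrow> ('a \<Rightarrow> real) \<Rightarrow> ('a \<Rightarrow> real) \<Rightarrow> bool" where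
  "eta_catastrophic X \<eta> f g \<longleftrightarrow>
     (INF y\<in>X. f y) \<le> \<eta> \<and> \<eta> < (SUP y\<in>X. f y) \<and>
     g \<in> value_functions X \<and>
     (\<forall>p \<in> distributions_on X. \<forall>\<Omega>. optimizer X \<Omega> \<longrightarrow>
        Limsup at_top (\<lambda>k. ereal (measure_pmf.expectation (\<Omega> k g p) f)) \<le> ereal \<eta>)"

definition catastrophic :: "'a set \<Rightarrow> ('a \<Rightarrow> real) \<Rightarrow> ('a \<Rightarrow> real) \<Rightarrow> bool" where
  "catastrophic X f g \<longleftrightarrow> eta_catastrophic X (INF y\<in>X. f y) f g"

end

theory Submission
  imports Defs
begin

text \<open>
  Optimizing \<open>g\<close> concentrates the mass on the maximizers of \<open>g\<close>, and an optimizer may pick any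
  single one of them; hence \<open>g\<close> is catastrophic for a nonconstant \<open>f\<close> iff every maximizer of \<open>g\<close> is
  a minimizer of \<open>f\<close>. Such a \<open>g\<close> must differ from \<open>f\<close> wherever \<open>f = 1\<close>, and at one more point:
  at a maximizer \<open>y\<close> of \<open>g\<close> if \<open>g y \<noteq> f y\<close>, and otherwise, since then \<open>g \<le> min f\<close>, at a point where
  \<open>f\<close> takes an intermediate value. Conversely, it suffices to lower \<open>f\<close> to its minimum wherever
  \<open>f = 1\<close> and to raise it to \<open>1\<close> at one minimizer.
\<close>

section \<open>Extrema and expectations over a finite set\<close>

lemma value_functionsD:
  assumes "f \<in> value_functions X" "x \<in> X"
  shows "0 \<le> f x" "f x \<le> 1"
  using assms by (auto simp: value_functions_def PiE_iff)

lemma finite_SUP_attained: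
  fixes h :: "'a \<Rightarrow> real"
  assumes "finite X" "X \<noteq> {}"
  obtains y where "y \<in> X" "h y = (SUP x\<in>X. h x)"
proof -
  have "(SUP x\<in>X. h x) \<in> h ` X"
    using assms by (simp add: cSup_eq_Max)
  then show thesis
    using that by auto
qed

lemma finite_INF_attained:
  fixes h :: "'a \<Rightarrow> real"
  assumes "finite X" "X \<noteq> {}"
  obtains y where "y \<in> X" "h y = (INF x\<in>X. h x)"
proof -
  have "(INF x\<in>X. h x) \<in> h ` X"
    using assms by (simp add: cInf_eq_Min)
  then show thesis
    using that by auto
qed

lemma finite_le_SUP:
  fixes h :: "'a \<Rightarrow> real"
  assumes "finite X" "x \<in> X"
  shows "h x \<le> (SUP y\<in>X. h y)"
  using assms by (intro cSUP_upper) auto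

lemma finite_INF_le:
  fixes h :: "'a \<Rightarrow> real"
  assumes "finite X" "x \<in> X"
  shows "(INF y\<in>X. h y) \<le> h x"
  using assms by (intro cINF_lower) auto

lemma expectation_mono_on:
  fixes f h :: "'a \<Rightarrow> real"
  assumes "finite X" "p \<in> distributions_on X" "\<And>x. x \<in> X \<Longrightarrow> f x \<le> h x"
  shows "measure_pmf.expectation p f \<le> measure_pmf.expectation p h"
proof (rule integral_mono_AE)
  have "finite (set_pmf p)"
    using assms by (auto simp: distributions_on_def intro: finite_subset)
  then show "integrable p f" "integrable p h"
    by (auto intro: integrable_measure_pmf_finite)
  show "AE x in p. f x \<le> h x"
    using assms by (auto simp: AE_measure_pmf_iff distributions_on_def)
qed

section \<open>Optimizers that jump to a prescribed maximizer\<close>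

definition jump_optimizer ::
  "(('a \<Rightarrow> real) \<Rightarrow> 'a) \<Rightarrow> real \<Rightarrow> ('a \<Rightarrow> real) \<Rightarrow> 'a pmf \<Rightarrow> 'a pmf" where
  "jump_optimizer c k h p = (if k = 0 then p else return_pmf (c h))"

text \<open>For every positive \<open>k\<close> the mass already sits on a maximizer of
  \<open>h\<close>, so both limits are limits of eventually constant functions. Monotonicity has
  content only at \<open>j = 0\<close>, where a mean is bounded by the maximum.\<close>

lemma optimizer_jump_optimizer:
  assumes "finite X" and c: "\<And>h. c h \<in> X" "\<And>h. h (c h) = (SUP x\<in>X. h x)"
  shows "optimizer X (jump_optimizer c)"
  unfolding optimizer_def
proof (intro ballI conjI allI impI)
  fix h :: "'a \<Rightarrow> real" and p
  assume p: "p \<in> distributions_on X"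
  have ev: "\<forall>\<^sub>F k::real in at_top. jump_optimizer c k h p = return_pmf (c h)"
    using eventually_gt_at_top[of 0] by eventually_elim (simp add: jump_optimizer_def)
  show "jump_optimizer c 0 h p = p"
    by (simp add: jump_optimizer_def)
  show "jump_optimizer c k h p \<in> distributions_on X" for k
    using p c(1) by (simp add: jump_optimizer_def distributions_on_def)
  show "measure_pmf.expectation (jump_optimizer c j h p) h
      \<le> measure_pmf.expectation (jump_optimizer c k h p) h" if "0 \<le> j" "j < k" for j k
  proof (cases "j = 0")
    case True
    have "measure_pmf.expectation p h \<le> measure_pmf.expectation p (\<lambda>_. h (c h))"
      using finite_le_SUP[OF assms(1), of _ h] by (intro expectation_mono_on[OF assms(1) p]) (simp add: c(2)[of h])
    then show ?thesis
      using True that by (simp add: jump_optimizer_def)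
  qed (use that in \<open>simp add: jump_optimizer_def\<close>)
  show "((\<lambda>k. measure_pmf.prob (jump_optimizer c k h p) {x \<in> X. h x > M}) \<longlongrightarrow> 1) at_top"
    if "M < (SUP y\<in>X. h y)" for M
    by (rule tendsto_eventually, use ev in eventually_elim)
      (use that c in \<open>simp add: measure_return_pmf\<close>)
  show "((\<lambda>k. measure_pmf.expectation (jump_optimizer c k h p) h) \<longlongrightarrow> (SUP y\<in>X. h y)) at_top"
    by (rule tendsto_eventually, use ev in eventually_elim) (use c in simp)
qed

section \<open>Catastrophe in terms of the maximizers of \<open>g\<close>\<close>

text \<open>Started at the point mass on \<open>y\<close>, an optimizer that selects
  \<open>y\<close> for \<open>g\<close> never moves, so its limsup is exactly
  \<open>f y\<close>.\<close>

lemma eta_catastrophic_imp_le: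
  assumes "finite X" and cat: "eta_catastrophic X \<eta> f g"
    and y: "y \<in> X" "g y = (SUP x\<in>X. g x)"
  shows "f y \<le> \<eta>"
proof -
  have "\<exists>z. z \<in> X \<and> h z = (SUP x\<in>X. h x)" for h :: "'a \<Rightarrow> real"
    using finite_SUP_attained[of X h] assms by blast
  then obtain c0 where c0: "c0 h \<in> X" "h (c0 h) = (SUP x\<in>X. h x)" for h :: "'a \<Rightarrow> real"
    by metis
  \<comment> \<open>An optimizer must act on every value function, so \<open>c0\<close> supplies
    maximizers elsewhere and only the choice at \<open>g\<close> is prescribed.\<close>
  define c where "c = c0(g := y)"
  have "optimizer X (jump_optimizer c)"
    using assms c0 by (intro optimizer_jump_optimizer) (auto simp: c_def)
  moreover have "return_pmf y \<in> distributions_on X"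
    using y by (simp add: distributions_on_def)
  ultimately have "Limsup at_top (\<lambda>k. ereal (measure_pmf.expectation
      (jump_optimizer c k g (return_pmf y)) f)) \<le> ereal \<eta>"
    using cat by (simp add: eta_catastrophic_def)
  moreover have "jump_optimizer c k g (return_pmf y) = return_pmf y" for k
    by (simp add: jump_optimizer_def c_def)
  ultimately show ?thesis
    by (simp add: Limsup_const)
qed

text \<open>Since \<open>X\<close> is finite, the maximum of \<open>g\<close> is isolated among its
  values. Condition (3) at a threshold in that gap sends the mass outside the maximizers to 0, and
  there \<open>f\<close> is bounded by its supremum.\<close>

lemma eta_catastrophicI:
  assumes fin: "finite X" and "X \<noteq> {}"
    and \<eta>: "(INF y\<in>X. f y) \<le> \<eta>" "\<eta> < (SUP y\<in>X. f y)" and g: "g \<in> value_functions X"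
    and max: "\<And>y. y \<in> X \<Longrightarrow> g y = (SUP x\<in>X. g x) \<Longrightarrow> f y \<le> \<eta>"
  shows "eta_catastrophic X \<eta> f g"
  unfolding eta_catastrophic_def
proof (intro conjI \<eta> g ballI allI impI)
  fix p \<Omega> assume p: "p \<in> distributions_on X" and \<Omega>: "optimizer X \<Omega>"
  let ?E = "\<lambda>k. measure_pmf.expectation (\<Omega> k g p)"
  let ?S = "SUP x\<in>X. g x" and ?F = "SUP x\<in>X. f x"
  \<comment> \<open>No value of \<open>g\<close> lies strictly between \<open>M\<close> and
    \<open>?S\<close>; the element \<open>?S - 1\<close> keeps the set nonempty when
    \<open>g\<close> is constant.\<close>
  define M where "M = Max (insert (?S - 1) (g ` {x \<in> X. g x < ?S}))"
  have M: "M < ?S" "\<And>x. x \<in> X \<Longrightarrow> g x < ?S \<Longrightarrow> g x \<le> M"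
    using fin by (auto simp: M_def)
  let ?A = "{x \<in> X. g x > M}"
  have bound: "?E k f \<le> \<eta> + (?F - \<eta>) * (1 - measure_pmf.prob (\<Omega> k g p) ?A)" if "k \<ge> 0" for k
  proof -
    have D: "\<Omega> k g p \<in> distributions_on X"
      using \<Omega> p g that by (auto simp: optimizer_def)
    \<comment> \<open>The dominating function is \<eta> on \<open>?A\<close>, which contains only
      maximizers, and \<open>?F\<close> elsewhere.\<close>
    have "?E k f \<le> ?E k (\<lambda>x. ?F - (?F - \<eta>) * indicator ?A x)"
    proof (rule expectation_mono_on[OF fin D])
      fix x assume x: "x \<in> X"
      show "f x \<le> ?F - (?F - \<eta>) * indicator ?A x"
      proof (cases "g x > M")
        case True
        then have "g x = ?S"
          using M(2)[OF x] finite_le_SUP[OF fin x, of g] by linarith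
        then show ?thesis
          using True x max by simp
      qed (use finite_le_SUP[OF fin x, of f] in simp)
    qed
    also have "\<dots> = ?F - (?F - \<eta>) * measure_pmf.prob (\<Omega> k g p) ?A"
    proof -
      have "integrable (\<Omega> k g p) (indicat_real ?A)"
        by (intro measure_pmf.integrable_const_bound[where B = 1]) auto
      then show ?thesis
        by simp
    qed
    finally show ?thesis
      by (simp add: algebra_simps)
  qed
  have "((\<lambda>k. measure_pmf.prob (\<Omega> k g p) ?A) \<longlongrightarrow> 1) at_top"
    using \<Omega> p g M(1) by (auto simp: optimizer_def)
  then have "((\<lambda>k. \<eta> + (?F - \<eta>) * (1 - measure_pmf.prob (\<Omega> k g p) ?A)) \<longlongrightarrow>
      \<eta> + (?F - \<eta>) * (1 - 1)) at_top"
    by (intro tendsto_intros)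
  then have "((\<lambda>k. ereal (\<eta> + (?F - \<eta>) * (1 - measure_pmf.prob (\<Omega> k g p) ?A))) \<longlongrightarrow> ereal \<eta>) at_top"
    by simp
  then have "Limsup at_top (\<lambda>k. ereal (\<eta> + (?F - \<eta>) * (1 - measure_pmf.prob (\<Omega> k g p) ?A))) = ereal \<eta>"
    by (intro lim_imp_Limsup) auto
  moreover have "Limsup at_top (\<lambda>k. ereal (?E k f)) \<le>
      Limsup at_top (\<lambda>k. ereal (\<eta> + (?F - \<eta>) * (1 - measure_pmf.prob (\<Omega> k g p) ?A)))"
    \<comment> \<open>Negative \<open>k\<close> are unconstrained, hence a comparison that holds
      only eventually.\<close>
    by (rule Limsup_mono, use eventually_ge_at_top[of 0] in eventually_elim) (use bound in simp)
  ultimately show "Limsup at_top (\<lambda>k. ereal (?E k f)) \<le> ereal \<eta>"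
    by simp
qed

lemma catastrophic_iff:
  assumes "finite X" "X \<noteq> {}" "(INF y\<in>X. f y) < (SUP y\<in>X. f y)" "g \<in> value_functions X"
  shows "catastrophic X f g \<longleftrightarrow>
    (\<forall>y\<in>X. g y = (SUP x\<in>X. g x) \<longrightarrow> f y = (INF x\<in>X. f x))"
proof
  assume "catastrophic X f g"
  then show "\<forall>y\<in>X. g y = (SUP x\<in>X. g x) \<longrightarrow> f y = (INF x\<in>X. f x)"
    using assms eta_catastrophic_imp_le finite_INF_le
    unfolding catastrophic_def by (metis order_antisym)
qed (use assms in \<open>auto simp: catastrophic_def intro!: eta_catastrophicI\<close>)

section \<open>Counting disagreements and the threshold for \<beta>\<close>

lemma F_proxy_iff_card:
  assumes "finite X" "X \<noteq> {}"
  shows "F_proxy X \<beta> f g \<longleftrightarrow>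
    g \<in> value_functions X \<and> real (card {x \<in> X. g x \<noteq> f x}) / real (card X) \<le> \<beta>"
proof -
  have "X \<inter> {x \<in> X. g x \<noteq> f x} = {x \<in> X. g x \<noteq> f x}"
    by auto
  then show ?thesis
    using assms by (simp add: F_proxy_def measure_pmf_of_set)
qed

lemma card_ge_3_intermediate:
  fixes A :: "real set"
  assumes "card A \<ge> 3"
  obtains b where "b \<in> A" "Inf A < b" "b < Sup A"
proof -
  have fin: "finite A" and "A \<noteq> {}"
    using assms card.infinite by fastforce+
  have "card {Inf A, Sup A} \<le> 2"
    by (simp add: card_insert_if)
  then have "\<not> A \<subseteq> {Inf A, Sup A}"
    using assms card_mono[of "{Inf A, Sup A}" A] by auto
  then obtain b where "b \<in> A" "b \<noteq> Inf A" "b \<noteq> Sup A"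
    by auto
  moreover from this have "Inf A \<le> b" "b \<le> Sup A"
    using fin by (auto intro: cInf_lower cSup_upper)
  ultimately show thesis
    using that by force
qed

theorem theorem4p2:
  fixes X :: "'a set" and f :: "'a \<Rightarrow> real" and \<beta> :: real
  assumes "finite X" and "X \<noteq> {}"
    and "0 < \<beta>" and "\<beta> < 1"
    and "f \<in> value_functions X"
    and "card (f ` X) \<ge> 3"
  shows "(\<exists>g \<in> value_functions X. F_proxy X \<beta> f g \<and> catastrophic X f g) \<longleftrightarrow>
         \<beta> \<ge> (real (card {x \<in> X. f x = 1}) + 1) / real (card X)"
proof -
  note fin = assms(1) and ne = assms(2) and f = assms(5)
  let ?m = "INF x\<in>X. f x" and ?X1 = "{x \<in> X. f x = 1}"
  obtain b where b: "b \<in> X" "?m < f b" "f b < (SUP x\<in>X. f x)"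
    using card_ge_3_intermediate[OF assms(6)] by auto
  \<comment> \<open>This puts \<open>b\<close> outside \<open>?X1\<close>, so it can serve as the
    additional point of disagreement.\<close>
  have "f b < 1"
    using b finite_SUP_attained[OF fin ne, of f] value_functionsD(2)[OF f] by (metis less_le_trans)
  with b have m1: "?m < 1"
    by linarith
  have cat: "catastrophic X f g \<longleftrightarrow> (\<forall>y\<in>X. g y = (SUP x\<in>X. g x) \<longrightarrow> f y = ?m)"
    if "g \<in> value_functions X" for g
    using fin ne b that by (intro catastrophic_iff) auto
  have X0: "real (card X) > 0"
    using fin ne by (simp add: card_gt_0_iff)
  show ?thesis
  proof
    assume "\<exists>g \<in> value_functions X. F_proxy X \<beta> f g \<and> catastrophic X f g"
    then obtain g where g: "g \<in> value_functions X" and proxy: "F_proxy X \<beta> f g"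
      and opt: "\<And>y. y \<in> X \<Longrightarrow> g y = (SUP x\<in>X. g x) \<Longrightarrow> f y = ?m"
      using cat by auto
    let ?D = "{x \<in> X. g x \<noteq> f x}"
    obtain y where y: "y \<in> X" "g y = (SUP x\<in>X. g x)"
      by (rule finite_SUP_attained[OF fin ne])
    have fy: "f y = ?m"
      using opt y by blast
    have le: "g x \<le> g y" if "x \<in> X" for x
      using finite_le_SUP[OF fin that, of g] y by simp
    have sub: "?X1 \<subseteq> ?D"
    proof
      fix x assume x: "x \<in> ?X1"
      have "g x \<noteq> 1"
      proof
        \<comment> \<open>The value 1 would make \<open>x\<close> a maximizer of \<open>g\<close>,
          forcing \<open>f x = ?m < 1\<close>.\<close>
        assume "g x = 1"
        with x y le value_functionsD(2)[OF g] have "g x = (SUP x\<in>X. g x)"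
          by (metis (lifting) mem_Collect_eq order_antisym)
        then show False
          using opt[of x] x m1 by auto
      qed
      then show "x \<in> ?D"
        using x by simp
    qed
    have "\<exists>z\<in>?D. z \<notin> ?X1"
    proof (cases "g y = f y")
      case True
      then have "g b < f b"
        using le[OF b(1)] b fy by linarith
      then show ?thesis
        using b \<open>f b < 1\<close> by (intro bexI[of _ b]) auto
    qed (use y fy m1 in auto)
    with sub have "card ?X1 < card ?D"
      using fin by (intro psubset_card_mono) auto
    \<comment> \<open>Strictness between natural numbers provides the \<open>+ 1\<close>.\<close>
    then have "(real (card ?X1) + 1) / real (card X) \<le> real (card ?D) / real (card X)"
      using X0 by (intro divide_right_mono) auto
    also have "\<dots> \<le> \<beta>"
      using proxy by (simp add: F_proxy_iff_card[OF fin ne])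
    finally show "\<beta> \<ge> (real (card ?X1) + 1) / real (card X)" .
  next
    assume \<beta>: "\<beta> \<ge> (real (card ?X1) + 1) / real (card X)"
    obtain z where z: "z \<in> X" "f z = ?m"
      by (rule finite_INF_attained[OF fin ne])
    \<comment> \<open>Removing the value 1 everywhere except at \<open>z\<close> makes
      \<open>z\<close> the unique maximizer. Outside \<open>X\<close>, \<open>g\<close> agrees with
      \<open>f\<close> and so remains extensional.\<close>
    define g where "g = (\<lambda>x. if x = z then 1 else if x \<in> ?X1 then ?m else f x)"
    have g: "g \<in> value_functions X"
      using f z(1) value_functionsD[OF f z(1)] z(2)
      by (auto simp: g_def value_functions_def PiE_iff extensional_def)
    have only_z: "x = z" if "x \<in> X" "g x = (SUP x\<in>X. g x)" for x
    proof (rule ccontr)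
      assume "x \<noteq> z"
      then have "g x < 1"
        using m1 value_functionsD(2)[OF f that(1)] by (auto simp: g_def that(1))
      then show False
        using finite_le_SUP[OF fin z(1), of g] that by (simp add: g_def)
    qed
    have "{x \<in> X. g x \<noteq> f x} \<subseteq> insert z ?X1"
      by (auto simp: g_def)
    then have "card {x \<in> X. g x \<noteq> f x} \<le> card (insert z ?X1)"
      using fin by (intro card_mono) auto
    also have "\<dots> \<le> card ?X1 + 1"
      using fin by (simp add: card_insert_if)
    finally have "real (card {x \<in> X. g x \<noteq> f x}) / real (card X)
        \<le> (real (card ?X1) + 1) / real (card X)"
      using X0 by (intro divide_right_mono) auto
    with \<beta> g have "F_proxy X \<beta> f g"
      by (simp add: F_proxy_iff_card[OF fin ne])
    moreover have "catastrophic X f g"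
      using cat[OF g] only_z z(2) by blast
    ultimately show "\<exists>g \<in> value_functions X. F_proxy X \<beta> f g \<and> catastrophic X f g"
      using g by blast
  qed
qed

end
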